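(* Let $A\in\mathbb{R}^{n\times n}$, $E\in\mathbb{R}^{n\times n_p}$, $G\in\mathbb{R}^{n\times n_w}$, $C_q\in\mathbb{R}^{n_q\times n}$, $D\in\mathbb{R}^{n_q\times n_p}$, and consider the system $$\dot x = A x + E\,p(t,x) + G w,$$ where $x\in\mathbb{R}^n$ is the state, $w\in\mathbb{R}^{n_w}$ is a disturbance, and $p$ takes values in $\mathbb{R}^{n_p}$. Let $\mathcal{M}$ be a set of symmetric $(n_q+n_p)\times(n_q+n_p)$ real matrices, and suppose that $p\in\mathcal{F}(\mathcal{M})$ (as defined in the context, with $q=C_qx+Dp$) and that $\mathcal{M}$ satisfies the Multiplier Condition of the context with the nonsingular matrix $T=\begin{bmatrix} T_{11} & T_{12} \\ T_{21} & T_{22} \end{bmatrix}$ and the convex set $\mathcal{N}$ of matrix pairs. Put $$\Gamma = T_{21}D+T_{22},\qquad \Lambda=(T_{11}D+T_{12})\Gamma^{-1},\qquad \Sigma=T_{11}-(T_{11}D+T_{12})\Gamma^{-1}T_{21}.$$ Suppose there exist $Q=Q^T>0$ in $\mathbb{R}^{n\times n}$, $(X,Y)\in\mathcal{N}$, $\lambda>0$, and $R=R^T>0$ in $\mathbb{R}^{n\times n}$ such that $$\begin{bmatrix} (A-E\Gamma^{-1}T_{21}C_q)Q+Q(A-E\Gamma^{-1}T_{21}C_q)^T+\lambda Q+R & E\Gamma^{-1}Y & QC_q^T\Sigma^T & G \\ Y\Gamma^{-T}E^T & -Y & Y\Lambda^T & 0 \\ \Sigma C_qQ & \Lambda Y &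 -X & 0 \\ G^T & 0 & 0 & -\lambda I \end{bmatrix}\le 0 .$$ Then, with $V(x):=x^TQ^{-1}x$ and $\dot V(x):=2x^TQ^{-1}\big(Ax+E\,p(t,x)+Gw\big)$ (the derivative of $V$ along the system), one has $$\dot V(x)+x^TQ^{-1}RQ^{-1}x\le 0$$ for all $t\in\mathbb{R}$, $x\in\mathbb{R}^n$ and $w\in\mathbb{R}^{n_w}$ such that $V(x)\ge\|w\|^2$.
   Context: For symmetric matrices, $S>0$ ($\ge 0$, $\le 0$) means positive definite (positive semidefinite, negative semidefinite); $\|\cdot\|$ is the Euclidean norm; $\Gamma^{-T}=(\Gamma^{-1})^T$. **The class $\mathcal{F}(\mathcal{M})$.** Given a set $\mathcal{M}$ of symmetric $(n_q+n_p)\times(n_q+n_p)$ real matrices, $p\in\mathcal{F}(\mathcal{M})$ with $q=C_qx+Dp$ means that for all $t\in\mathbb{R}$, all $x\in\mathbb{R}^n$ and all $M\in\mathcal{M}$, setting $p=p(t,x)\in\mathbb{R}^{n_p}$ and $q=C_qx+D\,p(t,x)\in\mathbb{R}^{n_q}$, $$\begin{bmatrix} q \\ p \end{bmatrix}^T M \begin{bmatrix} q \\ p \end{bmatrix}\ge 0 .$$ **Multiplier Condition on $\mathcal{M}$.** There exist a nonsingular matrix $T=\begin{bmatrix} T_{11} & T_{12} \\ T_{21} & T_{22} \end{bmatrix}$ with $T_{11}\in\mathbb{R}^{n_q\times n_q}$, $T_{12}\in\mathbb{R}^{n_q\times n_p}$, $T_{21}\in\mathbb{R}^{n_p\times n_q}$,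 $T_{22}\in\mathbb{R}^{n_p\times n_p}$, such that $T_{22}+T_{21}D$ is nonsingular, and a convex set $\mathcal{N}$ of pairs $(X,Y)$ of symmetric nonsingular matrices, $X\in\mathbb{R}^{n_q\times n_q}$, $Y\in\mathbb{R}^{n_p\times n_p}$, such that for each $(X,Y)\in\mathcal{N}$ $$M=T^T\begin{bmatrix} X^{-1} & 0 \\ 0 & -Y^{-1} \end{bmatrix} T\in\mathcal{M}.$$ Furthermore, $\mathcal{N}$ can be parameterized by a finite number of linear matrix inequalities (i.e. it is described by finitely many LMIs in $(X,Y)$ and possibly auxiliary variables). *)

theory Defs
  imports "HOL-Analysis.Analysis"
begin

definition symmetric_matrix :: "real^'n^'n \<Rightarrow> bool" where
  "symmetric_matrix S \<longleftrightarrow> transpose S = S"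

definition pos_definite :: "real^'n^'n \<Rightarrow> bool" where
  "pos_definite S \<longleftrightarrow> symmetric_matrix S \<and> (\<forall>x. x \<noteq> 0 \<longrightarrow> x \<bullet> (S *v x) > 0)"

definition neg_semidefinite :: "real^'n^'n \<Rightarrow> bool" where
  "neg_semidefinite S \<longleftrightarrow> symmetric_matrix S \<and> (\<forall>x. x \<bullet> (S *v x) \<le> 0)"

definition stack :: "real^'a \<Rightarrow> real^'b \<Rightarrow> real^('a + 'b)" where
  "stack u v = (\<chi> i. case i of Inl a \<Rightarrow> u $ a | Inr b \<Rightarrow> v $ b)"

definition block_matrix ::
  "real^'c^'a \<Rightarrow> real^'d^'a \<Rightarrow> real^'c^'b \<Rightarrow> real^'d^'b \<Rightarrow> real^('c + 'd)^('a + 'b)" where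
  "block_matrix M11 M12 M21 M22 = (\<chi> i j.
     case i of
       Inl a \<Rightarrow> (case j of Inl c \<Rightarrow> M11 $ a $ c | Inr d \<Rightarrow> M12 $ a $ d)
     | Inr b \<Rightarrow> (case j of Inl c \<Rightarrow> M21 $ b $ c | Inr d \<Rightarrow> M22 $ b $ d))"

definition block_matrix4 where
  "block_matrix4
     M11 M12 M13 M14
     M21 M22 M23 M24
     M31 M32 M33 M34
     M41 M42 M43 M44 =
   block_matrix
     (block_matrix M11 M12 M21 M22) (block_matrix M13 M14 M23 M24)
     (block_matrix M31 M32 M41 M42) (block_matrix M33 M34 M43 M44)"

definition class_F ::
  "(real^('q + 'p)^('q + 'p)) set \<Rightarrow> real^'n^'q \<Rightarrow> real^'p^'q \<Rightarrow> (real \<Rightarrow> real^'n \<Rightarrow> real^'p) \<Rightarrow> bool"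
  where
  "class_F \<M> Cq D p \<longleftrightarrow>
     (\<forall>t x. \<forall>M\<in>\<M>.
        let q = Cq *v x + D *v p t x; z = stack q (p t x)
        in z \<bullet> (M *v z) \<ge> 0)"

text \<open>
  A linear matrix inequality in the symmetric matrices \<open>X\<close>, \<open>Y\<close> and auxiliary real variables
  \<open>z 0, \<dots>, z (m - 1)\<close> is the requirement that an affine function of these variables, with values in
  the symmetric \<open>k \<times> k\<close> matrices, be positive definite (strict) or positive semidefinite.
  Different inequalities may have different sizes \<open>k\<close>, so the values are represented as functions
  of two indices below \<open>k\<close>. An auxiliary matrix variable is represented by its entries; an affine
  equation is a pair of nonstrict inequalities.
\<close>

record ('q, 'p) lmi =
  lmi_size :: nat
  lmi_strict :: bool
  lmi_const :: "nat \<Rightarrow> nat \<Rightarrow> real"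
  lmi_lin :: "nat \<Rightarrow> nat \<Rightarrow> (real^'q^'q) \<times> (real^'p^'p) \<Rightarrow> real"
  lmi_aux :: "nat \<Rightarrow> nat \<Rightarrow> nat \<Rightarrow> real"

definition lmi_entry ::
  "('q::finite, 'p::finite) lmi \<Rightarrow> nat \<Rightarrow> (real^'q^'q) \<times> (real^'p^'p) \<Rightarrow> (nat \<Rightarrow> real) \<Rightarrow> nat \<Rightarrow> nat \<Rightarrow> real"
  where
  "lmi_entry L m XY z i j = lmi_const L i j + lmi_lin L i j XY + (\<Sum>l<m. z l * lmi_aux L l i j)"

definition lmi_wellformed :: "nat \<Rightarrow> ('q::finite, 'p::finite) lmi \<Rightarrow> bool" where
  "lmi_wellformed m L \<longleftrightarrow>
     (\<forall>i<lmi_size L. \<forall>j<lmi_size L.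
        linear (lmi_lin L i j) \<and>
        (\<forall>X Y z. symmetric_matrix X \<and> symmetric_matrix Y \<longrightarrow>
           lmi_entry L m (X, Y) z i j = lmi_entry L m (X, Y) z j i))"

definition lmi_holds ::
  "nat \<Rightarrow> ('q::finite, 'p::finite) lmi \<Rightarrow> (real^'q^'q) \<times> (real^'p^'p) \<Rightarrow> (nat \<Rightarrow> real) \<Rightarrow> bool"
  where
  "lmi_holds m L XY z \<longleftrightarrow>
     (let k = lmi_size L;
          form = (\<lambda>v. \<Sum>i<k. \<Sum>j<k. v i * lmi_entry L m XY z i j * v j)
      in if lmi_strict L
         then \<forall>v. (\<exists>i<k. v i \<noteq> 0) \<longrightarrow> form v > 0
         else \<forall>v. form v \<ge> 0)"

definition lmi_parameterized :: "((real^'q^'q) \<times> (real^'p^'p)) set \<Rightarrow> bool" where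
  "lmi_parameterized \<N> \<longleftrightarrow>
     (\<exists>m Ls. (\<forall>L\<in>set Ls. lmi_wellformed m L) \<and>
        \<N> = {(X, Y). symmetric_matrix X \<and> symmetric_matrix Y \<and>
               (\<exists>z. \<forall>L\<in>set Ls. lmi_holds m L (X, Y) z)})"

definition multiplier_condition ::
  "(real^('q + 'p)^('q + 'p)) set \<Rightarrow> real^'p^'q \<Rightarrow>
   real^'q^'q \<Rightarrow> real^'p^'q \<Rightarrow> real^'q^'p \<Rightarrow> real^'p^'p \<Rightarrow>
   ((real^'q^'q) \<times> (real^'p^'p)) set \<Rightarrow> bool"
  where
  "multiplier_condition \<M> D T11 T12 T21 T22 \<N> \<longleftrightarrow>
     (let T = block_matrix T11 T12 T21 T22 in
        invertible T \<and>
        invertible (T22 + T21 ** D) \<and>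
        convex \<N> \<and>
        (\<forall>(X, Y)\<in>\<N>.
           symmetric_matrix X \<and> invertible X \<and> symmetric_matrix Y \<and> invertible Y \<and>
           transpose T ** block_matrix (matrix_inv X) 0 0 (- matrix_inv Y) ** T \<in> \<M>) \<and>
        lmi_parameterized \<N>)"

end

(* The matrix inequality is evaluated at the vector (Q^-1 x, Y^-1 z2, X^-1 z1, w), where (z1, z2) = T (q, p).
   The definitions of Gamma, Lambda and Sigma are made so that p = Gamma^-1 (z2 - T21 Cq x) and
   z1 = Sigma Cq x + Lambda z2; hence the quadratic form becomes
     Vdot + x^T Q^-1 R Q^-1 x + lambda (V - |w|^2) + (z1^T X^-1 z1 - z2^T Y^-1 z2),
   and the last two summands are nonnegative by V >= |w|^2 and by the multiplier inequality (S-procedure). *)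

theory Submission
  imports Defs
begin

text \<open>Rewriting \<open>UNIV\<close> of a sum type as a disjoint sum splits the index sum in
  two. The rule is used against its simp orientation, hence the \<open>del\<close>.\<close>

lemma inner_stack: "stack a b \<bullet> stack c d = a \<bullet> c + b \<bullet> d"
  by (simp add: inner_vec_def stack_def UNIV_Plus_UNIV[symmetric] sum.Plus del: UNIV_Plus_UNIV)

lemma block_matrix_mult_stack:
  "block_matrix A B C D *v stack u v = stack (A *v u + B *v v) (C *v u + D *v v)"
  by (simp add: vec_eq_iff matrix_vector_mult_def stack_def block_matrix_def
      UNIV_Plus_UNIV[symmetric] sum.Plus del: UNIV_Plus_UNIV split: sum.split)

lemma uminus_matrix_vector_mult:
  fixes A :: "real^'n^'m"
  shows "(- A) *v x = - (A *v x)"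
  by (simp add: vec_eq_iff matrix_vector_mult_def sum_negf)

text \<open>Removes every transpose from a quadratic form; both orientations serve as rewrite
  rules.\<close>

lemma inner_transpose_mult:
  fixes A :: "real^'n^'m"
  shows "x \<bullet> (transpose A *v y) = (A *v x) \<bullet> y" and "(transpose A *v y) \<bullet> x = y \<bullet> (A *v x)"
  by (metis dot_lmul_matrix inner_commute transpose_matrix_vector)+

lemma matrix_inv_mult_vec:
  fixes A :: "real^'n^'n"
  assumes "invertible A"
  shows "A *v (matrix_inv A *v x) = x" and "matrix_inv A *v (A *v x) = x"
proof -
  have "A ** matrix_inv A = mat 1 \<and> matrix_inv A ** A = mat 1"
    using assms unfolding invertible_def matrix_inv_def by (rule someI_ex)
  then show "A *v (matrix_inv A *v x) = x" and "matrix_inv A *v (A *v x) = x"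
    by (simp_all add: matrix_vector_mul_assoc)
qed

text \<open>The kernel is trivial, since \<open>S *v x = 0\<close> makes the form vanish at
  \<open>x\<close>.\<close>

lemma pos_definite_invertible:
  assumes "pos_definite S"
  shows "invertible S"
proof -
  have "x = 0" if "S *v x = 0" for x
    using assms that by (metis inner_zero_right less_irrefl pos_definite_def)
  then show ?thesis
    by (simp add: invertible_left_inverse matrix_left_invertible_ker)
qed

text \<open>Symmetry of \<open>S\<close> is applied to the pair \<open>matrix_inv S *v x\<close>,
  \<open>matrix_inv S *v y\<close>, whose images under \<open>S\<close> are \<open>x\<close> and
  \<open>y\<close>.\<close>

lemma inner_matrix_inv_symmetric:
  fixes S :: "real^'n^'n"
  assumes "symmetric_matrix S" and "invertible S"
  shows "x \<bullet> (matrix_inv S *v y) = (matrix_inv S *v x) \<bullet> y"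
  using inner_transpose_mult(1)[of "matrix_inv S *v x" S "matrix_inv S *v y"] assms
  by (simp add: matrix_inv_mult_vec symmetric_matrix_def del: transpose_matrix_vector)

theorem theorem1:
  fixes A :: "real^'n^'n" and E :: "real^'p^'n" and G :: "real^'w^'n"
    and Cq :: "real^'n^'q" and D :: "real^'p^'q"
    and p :: "real \<Rightarrow> real^'n \<Rightarrow> real^'p"
    and \<M> :: "(real^('q + 'p)^('q + 'p)) set"
    and T11 :: "real^'q^'q" and T12 :: "real^'p^'q" and T21 :: "real^'q^'p" and T22 :: "real^'p^'p"
    and \<N> :: "((real^'q^'q) \<times> (real^'p^'p)) set"
    and \<Gamma> :: "real^'p^'p" and \<Lambda> :: "real^'p^'q" and \<Sigma> :: "real^'q^'q"
    and Q R :: "real^'n^'n" and X :: "real^'q^'q" and Y :: "real^'p^'p" and lam :: real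
    and V :: "real^'n \<Rightarrow> real" and Vdot :: "real \<Rightarrow> real^'n \<Rightarrow> real^'w \<Rightarrow> real"
  assumes M_symmetric: "\<forall>M\<in>\<M>. symmetric_matrix M"
    and p_class: "class_F \<M> Cq D p"
    and multiplier: "multiplier_condition \<M> D T11 T12 T21 T22 \<N>"
    and Gamma: "\<Gamma> = T21 ** D + T22"
    and Lambda: "\<Lambda> = (T11 ** D + T12) ** matrix_inv \<Gamma>"
    and Sigma: "\<Sigma> = T11 - (T11 ** D + T12) ** matrix_inv \<Gamma> ** T21"
    and Q: "pos_definite Q"
    and XY: "(X, Y) \<in> \<N>"
    and lam: "lam > 0"
    and R: "pos_definite R"
    and LMI: "neg_semidefinite (block_matrix4
        ((A - E ** matrix_inv \<Gamma> ** T21 ** Cq) ** Q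
           + Q ** transpose (A - E ** matrix_inv \<Gamma> ** T21 ** Cq) + lam *\<^sub>R Q + R)
        (E ** matrix_inv \<Gamma> ** Y)
        (Q ** transpose Cq ** transpose \<Sigma>)
        G

        (Y ** transpose (matrix_inv \<Gamma>) ** transpose E)
        (- Y)
        (Y ** transpose \<Lambda>)
        0

        (\<Sigma> ** Cq ** Q)
        (\<Lambda> ** Y)
        (- X)
        0

        (transpose G)
        0
        0
        (- (lam *\<^sub>R mat 1)))"
    and V: "V = (\<lambda>x. x \<bullet> (matrix_inv Q *v x))"
    and Vdot: "Vdot = (\<lambda>t x w. 2 * (x \<bullet> (matrix_inv Q *v (A *v x + E *v p t x + G *v w))))"
  shows "\<forall>t x w. V x \<ge> (norm w)\<^sup>2 \<longrightarrow>
           Vdot t x w + x \<bullet> ((matrix_inv Q ** R ** matrix_inv Q) *v x) \<le> 0"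
proof (intro allI impI)
  fix t :: real and x :: "real^'n" and w :: "real^'w"
  assume Vw: "V x \<ge> (norm w)\<^sup>2"
  define pp where "pp = p t x"
  define q where "q = Cq *v x + D *v pp"
  define z1 where "z1 = T11 *v q + T12 *v pp"
  define z2 where "z2 = T21 *v q + T22 *v pp"
  define \<xi> where "\<xi> = matrix_inv Q *v x"
  define \<eta> where "\<eta> = matrix_inv Y *v z2"
  define \<zeta> where "\<zeta> = matrix_inv X *v z1"
  define As where "As = A - E ** matrix_inv \<Gamma> ** T21 ** Cq"
  let ?M = "transpose (block_matrix T11 T12 T21 T22) ** block_matrix (matrix_inv X) 0 0 (- matrix_inv Y)
    ** block_matrix T11 T12 T21 T22"
  have inv\<Gamma>: "invertible \<Gamma>" and invX: "invertible X" and invY: "invertible Y" and M: "?M \<in> \<M>"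
    using multiplier XY by (auto simp: multiplier_condition_def Let_def Gamma add.commute)
  have symQ: "symmetric_matrix Q" and invQ: "invertible Q"
    using Q pos_definite_invertible by (auto simp: pos_definite_def)
  \<comment> \<open>These equations absorb the factors \<open>Q\<close>, \<open>Y\<close> and
    \<open>X\<close> of the blocks.\<close>
  have Q\<xi>: "Q *v \<xi> = x" and Y\<eta>: "Y *v \<eta> = z2" and X\<zeta>: "X *v \<zeta> = z1"
    by (simp_all add: \<xi>_def \<eta>_def \<zeta>_def matrix_inv_mult_vec invQ invX invY)
  have z2: "z2 = T21 *v (Cq *v x) + \<Gamma> *v pp"
    by (simp add: z2_def q_def Gamma algebra_simps matrix_vector_mul_assoc matrix_vector_right_distrib
        matrix_vector_mult_add_rdistrib)
  then have pp: "matrix_inv \<Gamma> *v z2 = matrix_inv \<Gamma> *v (T21 *v (Cq *v x)) + pp"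
    by (simp add: matrix_vector_right_distrib matrix_inv_mult_vec inv\<Gamma>)
  \<comment> \<open>Expanding \<open>\<Lambda> *v z2\<close> by \<open>pp\<close> gives
    \<open>(T11 ** D + T12) *v pp\<close> and a term in \<open>T21 *v (Cq *v x)\<close>, which the
    correction in \<open>\<Sigma>\<close> cancels.\<close>
  have z1: "z1 = \<Sigma> *v (Cq *v x) + \<Lambda> *v z2"
    using pp by (simp add: z1_def q_def Lambda Sigma matrix_vector_mul_assoc[symmetric]
        matrix_vector_right_distrib matrix_vector_mult_add_rdistrib matrix_vector_mult_diff_rdistrib)
  \<comment> \<open>The same cancellation: the correction in \<open>As\<close> is compensated by the
    part of \<open>matrix_inv \<Gamma> *v z2\<close> that depends on \<open>x\<close>.\<close>
  have dyn: "As *v x + E *v (matrix_inv \<Gamma> *v z2) = A *v x + E *v pp"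
    using pp by (simp add: As_def matrix_vector_mul_assoc[symmetric]
        matrix_vector_right_distrib matrix_vector_mult_diff_rdistrib)
  have "stack q pp \<bullet> (?M *v stack q pp) \<ge> 0"
    using p_class M unfolding class_F_def Let_def q_def pp_def by blast
  \<comment> \<open>The outer factors of \<open>?M\<close> send \<open>stack q pp\<close> to
    \<open>stack z1 z2\<close>, so only the block diagonal form remains.\<close>
  then have mult: "\<zeta> \<bullet> z1 - \<eta> \<bullet> z2 \<ge> 0"
    by (simp add: matrix_vector_mul_assoc[symmetric] inner_transpose_mult block_matrix_mult_stack
        inner_stack z1_def[symmetric] z2_def[symmetric] \<zeta>_def \<eta>_def inner_commute
        uminus_matrix_vector_mult del: transpose_matrix_vector)
  \<comment> \<open>\<open>As\<close> stays folded here so that \<open>dyn\<close> can be applied as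
    a rewrite rule later.\<close>
  have "stack (stack \<xi> \<eta>) (stack \<zeta> w) \<bullet> (block_matrix4
        (As ** Q + Q ** transpose As + lam *\<^sub>R Q + R) (E ** matrix_inv \<Gamma> ** Y)
        (Q ** transpose Cq ** transpose \<Sigma>) G
        (Y ** transpose (matrix_inv \<Gamma>) ** transpose E) (- Y) (Y ** transpose \<Lambda>) 0
        (\<Sigma> ** Cq ** Q) (\<Lambda> ** Y) (- X) 0
        (transpose G) 0 0 (- (lam *\<^sub>R mat 1)) *v stack (stack \<xi> \<eta>) (stack \<zeta> w)) \<le> 0"
    using LMI unfolding neg_semidefinite_def As_def by blast
  \<comment> \<open>Symmetry of \<open>Q\<close>, and of \<open>Y\<close> below, handles the blocks
    in which these matrices stand on the left.\<close>
  moreover have "\<xi> \<bullet> (Q *v y) = x \<bullet> y" for y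
    using inner_transpose_mult(1)[of \<xi> Q y] symQ Q\<xi>
    by (simp add: symmetric_matrix_def del: transpose_matrix_vector)
  moreover have "\<eta> \<bullet> (Y *v y) = z2 \<bullet> y" for y
    using inner_transpose_mult(1)[of \<eta> Y y] multiplier XY Y\<eta>
    by (auto simp: multiplier_condition_def Let_def symmetric_matrix_def simp del: transpose_matrix_vector)
  \<comment> \<open>Each off-diagonal block and its transpose contribute equally, whence the factors
    2; \<open>As ** Q\<close> pairs likewise with \<open>Q ** transpose As\<close>.\<close>
  ultimately have "2 * (\<xi> \<bullet> (As *v x + E *v (matrix_inv \<Gamma> *v z2) + G *v w)) + \<xi> \<bullet> (R *v \<xi>)
      + lam * (\<xi> \<bullet> x - w \<bullet> w) + 2 * (\<zeta> \<bullet> (\<Sigma> *v (Cq *v x) + \<Lambda> *v z2)) - \<eta> \<bullet> z2 - \<zeta> \<bullet> z1 \<le> 0"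
    by (simp add: block_matrix4_def block_matrix_mult_stack inner_stack
        matrix_vector_mul_assoc[symmetric] inner_transpose_mult matrix_vector_mult_add_rdistrib
        scaleR_matrix_vector_assoc[symmetric] uminus_matrix_vector_mult
        Q\<xi> Y\<eta> X\<zeta> inner_add_right inner_add_left algebra_simps inner_commute
        del: transpose_matrix_vector)
  \<comment> \<open>The block \<open>- X\<close> takes away one of the two copies of
    \<open>\<zeta> \<bullet> z1\<close>, which leaves exactly the expression in
    \<open>mult\<close>.\<close>
  then have "2 * (\<xi> \<bullet> (A *v x + E *v pp + G *v w)) + \<xi> \<bullet> (R *v \<xi>)
      + lam * (\<xi> \<bullet> x - w \<bullet> w) + (\<zeta> \<bullet> z1 - \<eta> \<bullet> z2) \<le> 0"
    unfolding dyn z1[symmetric] by linarith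
  moreover have "lam * (\<xi> \<bullet> x - w \<bullet> w) \<ge> 0"
    using Vw lam by (simp add: V \<xi>_def inner_commute power2_norm_eq_inner)
  moreover have "Vdot t x w = 2 * (\<xi> \<bullet> (A *v x + E *v pp + G *v w))"
    by (simp only: Vdot \<xi>_def pp_def inner_matrix_inv_symmetric[OF symQ invQ])
  moreover have "x \<bullet> ((matrix_inv Q ** R ** matrix_inv Q) *v x) = \<xi> \<bullet> (R *v \<xi>)"
    by (simp add: \<xi>_def matrix_vector_mul_assoc[symmetric] inner_matrix_inv_symmetric[OF symQ invQ])
  ultimately show "Vdot t x w + x \<bullet> ((matrix_inv Q ** R ** matrix_inv Q) *v x) \<le> 0"
    using mult by linarith
qed

end
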